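(* Let $I_{xx},I_{yy},I_{zz},I_{B_R},I_{B_Y}$ be positive real numbers, and put $I_{xx}'=I_{xx}+I_{B_R}$, $I_{zz}'=I_{zz}+I_{B_R}$, $$\alpha=\frac{(I_{xx}-I_{zz})(I_{xx}-I_{yy}+2I_{B_R}+I_{zz})}{2(I_{B_R}+I_{zz})(I_{xx}+I_{B_R})},\qquad \beta=-\frac{I_{xx}-I_{yy}-I_{zz}}{I_{B_R}+I_{zz}},$$ $$c_1=-\frac{I_{xx}-I_{zz}}{2(I_{B_Y}+I_{yy})},\qquad c_2=-\frac{(I_{zz}+I_{B_R})(I_{xx}+I_{yy}-I_{zz})}{(I_{B_Y}+I_{yy})(I_{xx}+I_{B_R})},$$ $u_1=2\alpha+\beta-1$ and $\sigma=-(I_{yy}-I_{xx}')(I_{yy}-I_{zz}')$. Suppose $\sigma<0$ and let $\lambda=\sqrt{-\sigma/(I_{xx}'I_{zz}')}$. Then the solution of the system $$\dot x=\alpha\sin(2\tau)\,x+\bigl(\alpha\cos(2\tau)+(\alpha+\beta)\bigr)z+\sin\tau,$$ $$\dot y=c_1\bigl(2\cos(2\tau)\,xz+\sin(2\tau)(x^2-z^2)\bigr)+c_2\bigl(\sin(\tau)\,x+\cos(\tau)\,z\bigr),$$ $$\dot z=\bigl(\alpha\cos(2\tau)-(\alpha+\beta)\bigr)x-\alpha\sin(2\tau)\,z+\cos\tau$$ with $x(0)=y(0)=z(0)=0$ is $$x(\tau)=\frac1{\lambda^2}\bigl(\lambda\sin\tau\sin(\lambda\tau)-u_1\cos\tau\,(\cos(\lambda\tau)-1)\bigr),$$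 $$y(\tau)=\frac{c_1u_1}{\lambda^4}(\cos(\lambda\tau)-1)^2-\frac{c_2}{\lambda^2}(\cos(\lambda\tau)-1),$$ $$z(\tau)=\frac1{\lambda^2}\bigl(\lambda\cos\tau\sin(\lambda\tau)+u_1\sin\tau\,(\cos(\lambda\tau)-1)\bigr).$$
   Context: The functions $x,y,z$ are the first-order perturbation components $\hat\omega_x^{(1)},\hat\omega_y^{(1)},\hat\omega_z^{(1)}$ of the dimensionless angular velocity of a spacecraft platform carrying an unbalanced rotor, with the platform initially at rest; a dot denotes $d/d\tau$, where $\tau$ is dimensionless time. The numbers $I_{xx},I_{yy},I_{zz}$ are diagonal entries of the equivalent spin inertia tensor in the rotor frame, and $I_{B_R},I_{B_Y}$ are the transverse and axial moments of inertia of the platform. *)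

theory Defs
  imports "HOL-Analysis.Analysis"
begin

text \<open>
  Derivatives are taken within \<open>T\<close>, hence one-sided at an endpoint belonging to \<open>T\<close>;
  in particular \<open>T = {0..}\<close> expresses forward time.
\<close>

definition first_order_ivp_solution ::
  "real \<Rightarrow> real \<Rightarrow> real \<Rightarrow> real \<Rightarrow> real set \<Rightarrow>
    (real \<Rightarrow> real) \<Rightarrow> (real \<Rightarrow> real) \<Rightarrow> (real \<Rightarrow> real) \<Rightarrow> bool" where
  "first_order_ivp_solution \<alpha> \<beta> c1 c2 T x y z \<longleftrightarrow>
     x 0 = 0 \<and> y 0 = 0 \<and> z 0 = 0 \<and>
     (\<forall>\<tau>\<in>T.
        (x has_real_derivative
           (\<alpha> * sin (2 * \<tau>) * x \<tau> + (\<alpha> * cos (2 * \<tau>) + (\<alpha> + \<beta>)) * z \<tau> + sin \<tau>))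
          (at \<tau> within T) \<and>
        (y has_real_derivative
           (c1 * (2 * cos (2 * \<tau>) * x \<tau> * z \<tau> + sin (2 * \<tau>) * ((x \<tau>)\<^sup>2 - (z \<tau>)\<^sup>2))
            + c2 * (sin \<tau> * x \<tau> + cos \<tau> * z \<tau>)))
          (at \<tau> within T) \<and>
        (z has_real_derivative
           ((\<alpha> * cos (2 * \<tau>) - (\<alpha> + \<beta>)) * x \<tau> - \<alpha> * sin (2 * \<tau>) * z \<tau> + cos \<tau>))
          (at \<tau> within T))"

end

theory Submission
  imports Defs
begin

text \<open>
  The coefficients of the \<open>x\<close>-\<open>z\<close> system rotate with angle \<open>\<tau>\<close>. In the corotating components
  \<open>p = cos \<tau> x - sin \<tau> z\<close> and \<open>q = sin \<tau> x + cos \<tau> z\<close> the system becomes autonomous: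
  \<open>p' = u q\<close> and \<open>q' = (1 - \<beta>) p + 1\<close> with \<open>u = 2\<alpha> + \<beta> - 1\<close>
  (lemma \<open>corotating_field_iff\<close>). Substituting the moments of inertia gives
  \<open>u = (Iyy - Izz') / Ixx'\<close> and \<open>\<beta> - 1 = (Iyy - Ixx') / Izz'\<close>, so \<open>u (\<beta> - 1) = \<lambda>\<^sup>2 > 0\<close>:
  this is a forced harmonic oscillator with frequency \<open>\<lambda>\<close>, whose solution from rest is
  \<open>p = (u / \<lambda>\<^sup>2) (1 - cos (\<lambda>\<tau>))\<close>, \<open>q = sin (\<lambda>\<tau>) / \<lambda>\<close>. Uniqueness follows from conservation of
  a definite quadratic energy by the difference of two solutions
  (lemma \<open>forced_oscillator_from_rest_iff\<close>).

  The right-hand side of the \<open>y\<close> equation is \<open>2 c1 p q + c2 q\<close>. Since \<open>q = p' / u\<close>, it is the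
  derivative of \<open>(c1 p\<^sup>2 + c2 p) / u\<close>, which is the stated formula for \<open>y\<close>.
\<close>

text \<open>
  The difference \<open>(P, Q)\<close> from the closed form solves \<open>P' = a Q\<close>, \<open>Q' = b P\<close>, so
  \<open>a Q\<^sup>2 - b P\<^sup>2\<close> is constant, hence zero. After multiplication by \<open>a\<close> it reads
  \<open>a\<^sup>2 Q\<^sup>2 + \<omega>\<^sup>2 P\<^sup>2\<close>, which is positive definite.
\<close>
lemma forced_oscillator_from_rest_iff:
  fixes a b \<omega> :: real and T :: "real set" and p q :: "real \<Rightarrow> real"
  assumes \<omega>: "\<omega> \<noteq> 0" "\<omega>\<^sup>2 = - (a * b)" and T: "is_interval T" "0 \<in> T"
  shows "(p 0 = 0 \<and> q 0 = 0 \<and>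
      (\<forall>t\<in>T. (p has_real_derivative a * q t) (at t within T) \<and>
             (q has_real_derivative b * p t + 1) (at t within T))) \<longleftrightarrow>
    (\<forall>t\<in>T. p t = a / \<omega>\<^sup>2 * (1 - cos (\<omega> * t)) \<and> q t = sin (\<omega> * t) / \<omega>)"
    (is "?ode p q \<longleftrightarrow> ?closed")
proof -
  let ?p = "\<lambda>t. a / \<omega>\<^sup>2 * (1 - cos (\<omega> * t))" and ?q = "\<lambda>t. sin (\<omega> * t) / \<omega>"
  have ab: "a \<noteq> 0" "b \<noteq> 0"
    using \<omega> by auto
  have dp: "(?p has_real_derivative a * ?q t) (at t within T)" for t
    using \<omega>(1) by (auto intro!: derivative_eq_intros simp: field_simps power2_eq_square)
  have dq: "(?q has_real_derivative b * ?p t + 1) (at t within T)" for t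
  proof -
    have "(?q has_real_derivative cos (\<omega> * t)) (at t within T)"
      using \<omega>(1) by (auto intro!: derivative_eq_intros)
    moreover have "cos (\<omega> * t) = b * ?p t + 1"
      unfolding \<omega>(2) using ab by (simp add: field_simps)
    ultimately show ?thesis
      by simp
  qed
  show ?thesis
  proof
    assume ode: "?ode p q"
    define P Q where "P = (\<lambda>t. p t - ?p t)" and "Q = (\<lambda>t. q t - ?q t)"
    define E where "E = (\<lambda>t. a * (Q t)\<^sup>2 - b * (P t)\<^sup>2)"
    have dE: "(E has_real_derivative 0) (at t within T)" if "t \<in> T" for t
    proof -
      have P': "(P has_real_derivative a * Q t) (at t within T)"
        unfolding P_def Q_def using DERIV_diff[OF _ dp] ode that
        by (simp add: right_diff_distrib)
      have "(Q has_real_derivative (b * p t + 1) - (b * ?p t + 1)) (at t within T)"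
        unfolding Q_def by (rule DERIV_diff[OF _ dq]) (use ode that in blast)
      then have Q': "(Q has_real_derivative b * P t) (at t within T)"
        unfolding P_def by (simp add: right_diff_distrib)
      show ?thesis
        unfolding E_def by (rule derivative_eq_intros P' Q' refl)+ simp
    qed
    have "convex T"
      using T(1) is_interval_convex by blast
    then obtain c where c: "\<And>t. t \<in> T \<Longrightarrow> E t = c"
      using has_field_derivative_zero_constant[of T E] dE by auto
    have E0: "E t = 0" if "t \<in> T" for t
      using c[OF that] c[OF T(2)] ode by (simp add: E_def P_def Q_def)
    show ?closed
    proof
      fix t assume "t \<in> T"
      have "(a * Q t)\<^sup>2 + (\<omega> * P t)\<^sup>2 = a * E t"
        unfolding E_def power_mult_distrib \<omega>(2) by (simp add: algebra_simps power2_eq_square)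
      also have "\<dots> = 0"
        using E0 \<open>t \<in> T\<close> by simp
      finally have "a * Q t = 0" "\<omega> * P t = 0"
        by (simp_all add: sum_power2_eq_zero_iff)
      then show "p t = ?p t \<and> q t = ?q t"
        using ab \<omega>(1) by (simp add: P_def Q_def)
    qed
  next
    assume closed: ?closed
    show "?ode p q"
    proof (intro conjI ballI)
      show "p 0 = 0" "q 0 = 0"
        using closed T(2) by auto
    next
      fix t assume t: "t \<in> T"
      show "(p has_real_derivative a * q t) (at t within T)"
        using has_field_derivative_transform_within[OF dp zero_less_one t, of p] closed t by simp
      show "(q has_real_derivative b * p t + 1) (at t within T)"
        using has_field_derivative_transform_within[OF dq zero_less_one t, of q] closed t by simp
    qed
  qed
qed

lemma rotation_inverse:
  fixes x z t :: real
  shows "cos t * (cos t * x - sin t * z) + sin t * (sin t * x + cos t * z) = x"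
    and "cos t * (sin t * x + cos t * z) - sin t * (cos t * x - sin t * z) = z"
  using sin_cos_squared_add[of t] by algebra+

text \<open>
  The double-angle terms are a reflection whose axis turns with the frame, so in the corotating
  components they become the constant swap of \<open>p\<close> and \<open>q\<close>; the forcing \<open>(sin t, cos t)\<close> becomes
  the constant \<open>(0, 1)\<close>, and the turning of the frame contributes \<open>-q\<close> and \<open>+p\<close>.
\<close>
lemma corotating_field_iff:
  fixes \<alpha> \<beta> t :: real and T :: "real set" and x z :: "real \<Rightarrow> real"
  defines "p \<equiv> \<lambda>s. cos s * x s - sin s * z s" and "q \<equiv> \<lambda>s. sin s * x s + cos s * z s"
  shows "((x has_real_derivative
            (\<alpha> * sin (2 * t) * x t + (\<alpha> * cos (2 * t) + (\<alpha> + \<beta>)) * z t + sin t)) (at t within T) \<and>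
          (z has_real_derivative
            ((\<alpha> * cos (2 * t) - (\<alpha> + \<beta>)) * x t - \<alpha> * sin (2 * t) * z t + cos t)) (at t within T)) \<longleftrightarrow>
         ((p has_real_derivative (2 * \<alpha> + \<beta> - 1) * q t) (at t within T) \<and>
          (q has_real_derivative (1 - \<beta>) * p t + 1) (at t within T))"
    (is "(x has_real_derivative ?x') _ \<and> (z has_real_derivative ?z') _ \<longleftrightarrow> ?pq")
proof -
  have x: "x = (\<lambda>s. cos s * p s + sin s * q s)" and z: "z = (\<lambda>s. cos s * q s - sin s * p s)"
    unfolding p_def q_def by (simp_all add: rotation_inverse)
  define C S where "C = cos t" and "S = sin t"
  have CS: "C * C = 1 - S * S"
    using sin_cos_squared_add[of t] by (simp add: C_def S_def power2_eq_square)
  have double: "sin (2 * t) = 2 * S * C" "cos (2 * t) = 1 - 2 * (S * S)"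
    using CS by (simp_all add: sin_double cos_double C_def S_def power2_eq_square)
  have pt: "p t = C * x t - S * z t" and qt: "q t = S * x t + C * z t"
    by (simp_all add: p_def q_def C_def S_def)
  have p': "C * ?x' - S * ?z' - q t = (2 * \<alpha> + \<beta> - 1) * q t"
    unfolding double pt qt C_def[symmetric] S_def[symmetric] using CS by algebra
  have q': "S * ?x' + C * ?z' + p t = (1 - \<beta>) * p t + 1"
    unfolding double pt qt C_def[symmetric] S_def[symmetric] using CS by algebra
  show ?thesis
  proof
    assume d: "(x has_real_derivative ?x') (at t within T) \<and>
      (z has_real_derivative ?z') (at t within T)"
    have "(p has_real_derivative C * ?x' - S * ?z' - q t) (at t within T)"
      unfolding p_def qt C_def S_def
      by (rule derivative_eq_intros conjunct1[OF d] conjunct2[OF d] refl)+ simp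
    moreover have "(q has_real_derivative S * ?x' + C * ?z' + p t) (at t within T)"
      unfolding q_def pt C_def S_def
      by (rule derivative_eq_intros conjunct1[OF d] conjunct2[OF d] refl)+ simp
    ultimately show ?pq
      unfolding p' q' by blast
  next
    assume d: ?pq
    let ?p' = "C * ?x' - S * ?z' - q t" and ?q' = "S * ?x' + C * ?z' + p t"
    have dp: "(p has_real_derivative ?p') (at t within T)"
      and dq: "(q has_real_derivative ?q') (at t within T)"
      unfolding p' q' using d by blast+
    have "((\<lambda>s. cos s * p s + sin s * q s) has_real_derivative
        C * (?p' + q t) + S * (?q' - p t)) (at t within T)"
      unfolding C_def S_def by (rule derivative_eq_intros dp dq refl)+ (simp add: algebra_simps C_def S_def)
    moreover have "C * (?p' + q t) + S * (?q' - p t) = ?x'"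
      using rotation_inverse(1)[of t ?x' ?z'] by (simp add: C_def S_def)
    ultimately have dx: "(x has_real_derivative ?x') (at t within T)"
      using x by simp
    have "((\<lambda>s. cos s * q s - sin s * p s) has_real_derivative
        C * (?q' - p t) - S * (?p' + q t)) (at t within T)"
      unfolding C_def S_def by (rule derivative_eq_intros dp dq refl)+ (simp add: algebra_simps C_def S_def)
    moreover have "C * (?q' - p t) - S * (?p' + q t) = ?z'"
      using rotation_inverse(2)[of t ?x' ?z'] by (simp add: C_def S_def)
    ultimately have dz: "(z has_real_derivative ?z') (at t within T)"
      using z by simp
    from dx dz show "(x has_real_derivative ?x') (at t within T) \<and>
      (z has_real_derivative ?z') (at t within T)" ..
  qed
qed

lemma corotating_y_rate:
  fixes c1 c2 t x z :: real
  shows "c1 * (2 * cos (2 * t) * x * z + sin (2 * t) * (x\<^sup>2 - z\<^sup>2)) + c2 * (sin t * x + cos t * z)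
    = (2 * c1 * (cos t * x - sin t * z) + c2) * (sin t * x + cos t * z)"
  unfolding sin_double cos_double by algebra

lemma antiderivative_from_zero_iff:
  fixes y G g :: "real \<Rightarrow> real"
  assumes G: "\<And>t. t \<in> T \<Longrightarrow> (G has_real_derivative g t) (at t within T)" "G 0 = 0"
    and T: "is_interval T" "0 \<in> T"
  shows "(y 0 = 0 \<and> (\<forall>t\<in>T. (y has_real_derivative g t) (at t within T))) \<longleftrightarrow> (\<forall>t\<in>T. y t = G t)"
proof
  assume y: "y 0 = 0 \<and> (\<forall>t\<in>T. (y has_real_derivative g t) (at t within T))"
  have "((\<lambda>t. y t - G t) has_real_derivative 0) (at t within T)" if "t \<in> T" for t
    using DERIV_diff[OF _ G(1)[OF that]] y that by fastforce
  moreover have "convex T"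
    using T(1) is_interval_convex by blast
  ultimately obtain c where "\<And>t. t \<in> T \<Longrightarrow> y t - G t = c"
    using has_field_derivative_zero_constant[of T "\<lambda>t. y t - G t"] by auto
  from this this[OF T(2)] show "\<forall>t\<in>T. y t = G t"
    using y G(2) by simp
next
  assume "\<forall>t\<in>T. y t = G t"
  then show "y 0 = 0 \<and> (\<forall>t\<in>T. (y has_real_derivative g t) (at t within T))"
    using G(2) T(2) by (auto intro!: has_field_derivative_transform_within[OF G(1) zero_less_one])
qed

text \<open>
  The two corotating components decouple from \<open>y\<close>, so they are determined first and \<open>y\<close> is then a
  single integration. The relation \<open>\<omega>\<^sup>2 = u (\<beta> - 1)\<close> is what remains of the moments of inertia: it
  makes \<open>\<omega>\<close> the frequency of the oscillator.
\<close>
lemma first_order_ivp_solution_iff: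
  fixes \<alpha> \<beta> c1 c2 u \<omega> :: real and T :: "real set" and x y z :: "real \<Rightarrow> real"
  assumes u: "u = 2 * \<alpha> + \<beta> - 1" and \<omega>: "\<omega> \<noteq> 0" "\<omega>\<^sup>2 = u * (\<beta> - 1)"
    and T: "is_interval T" "0 \<in> T"
  shows "first_order_ivp_solution \<alpha> \<beta> c1 c2 T x y z \<longleftrightarrow>
    (\<forall>t\<in>T.
       x t = 1 / \<omega>\<^sup>2 * (\<omega> * sin t * sin (\<omega> * t) - u * cos t * (cos (\<omega> * t) - 1)) \<and>
       y t = c1 * u / \<omega> ^ 4 * (cos (\<omega> * t) - 1)\<^sup>2 - c2 / \<omega>\<^sup>2 * (cos (\<omega> * t) - 1) \<and>
       z t = 1 / \<omega>\<^sup>2 * (\<omega> * cos t * sin (\<omega> * t) + u * sin t * (cos (\<omega> * t) - 1)))"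
proof -
  define p q where "p = (\<lambda>s. cos s * x s - sin s * z s)" and "q = (\<lambda>s. sin s * x s + cos s * z s)"
  define p0 q0 where "p0 = (\<lambda>t. u / \<omega>\<^sup>2 * (1 - cos (\<omega> * t)))" and "q0 = (\<lambda>t. sin (\<omega> * t) / \<omega>)"
  define y0 where
    "y0 = (\<lambda>t. c1 * u / \<omega> ^ 4 * (cos (\<omega> * t) - 1)\<^sup>2 - c2 / \<omega>\<^sup>2 * (cos (\<omega> * t) - 1))"
  have u0: "u \<noteq> 0"
    using \<omega> by auto
  have y0_p0: "y0 = (\<lambda>t. (c1 * (p0 t)\<^sup>2 + c2 * p0 t) / u)"
    unfolding y0_def p0_def using u0 \<omega>(1)
    by (intro ext) (simp add: field_simps power2_eq_square power4_eq_xxxx)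
  have dp0: "(p0 has_real_derivative u * q0 t) (at t within T)" for t
    unfolding p0_def q0_def using \<omega>(1)
    by (auto intro!: derivative_eq_intros simp: field_simps power2_eq_square)
  have dy0: "(y0 has_real_derivative (2 * c1 * p0 t + c2) * q0 t) (at t within T)" for t
    unfolding y0_p0
    by (rule derivative_eq_intros dp0 refl)+ (use u0 in \<open>simp_all add: field_simps\<close>)
  have oscillator: "(p 0 = 0 \<and> q 0 = 0 \<and>
      (\<forall>t\<in>T. (p has_real_derivative u * q t) (at t within T) \<and>
             (q has_real_derivative (1 - \<beta>) * p t + 1) (at t within T))) \<longleftrightarrow>
    (\<forall>t\<in>T. p t = p0 t \<and> q t = q0 t)"
    unfolding p0_def q0_def
    by (rule forced_oscillator_from_rest_iff) (use \<omega> T in \<open>simp_all add: algebra_simps\<close>)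
  have "first_order_ivp_solution \<alpha> \<beta> c1 c2 T x y z \<longleftrightarrow>
      (p 0 = 0 \<and> q 0 = 0 \<and>
        (\<forall>t\<in>T. (p has_real_derivative u * q t) (at t within T) \<and>
               (q has_real_derivative (1 - \<beta>) * p t + 1) (at t within T))) \<and>
      y 0 = 0 \<and> (\<forall>t\<in>T. (y has_real_derivative (2 * c1 * p t + c2) * q t) (at t within T))"
    using corotating_field_iff[of x \<alpha> _ \<beta> z T]
    unfolding first_order_ivp_solution_def corotating_y_rate u p_def q_def by auto
  also have "\<dots> \<longleftrightarrow> (\<forall>t\<in>T. p t = p0 t \<and> q t = q0 t) \<and> y 0 = 0 \<and>
      (\<forall>t\<in>T. (y has_real_derivative (2 * c1 * p0 t + c2) * q0 t) (at t within T))"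
    unfolding oscillator by auto
  also have "\<dots> \<longleftrightarrow> (\<forall>t\<in>T. p t = p0 t \<and> q t = q0 t) \<and> (\<forall>t\<in>T. y t = y0 t)"
    using antiderivative_from_zero_iff[of T y0 "\<lambda>t. (2 * c1 * p0 t + c2) * q0 t" y] dy0 T
    by (simp add: y0_def)
  also have "\<dots> \<longleftrightarrow> (\<forall>t\<in>T. x t = cos t * p0 t + sin t * q0 t \<and> y t = y0 t \<and>
      z t = cos t * q0 t - sin t * p0 t)"
  proof -
    have "p t = p0 t \<and> q t = q0 t \<longleftrightarrow>
        x t = cos t * p0 t + sin t * q0 t \<and> z t = cos t * q0 t - sin t * p0 t" for t
    proof
      assume "p t = p0 t \<and> q t = q0 t"
      then show "x t = cos t * p0 t + sin t * q0 t \<and> z t = cos t * q0 t - sin t * p0 t"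
        using rotation_inverse[of t "x t" "z t"] unfolding p_def q_def by simp
    next
      assume xz: "x t = cos t * p0 t + sin t * q0 t \<and> z t = cos t * q0 t - sin t * p0 t" show "p t = p0 t \<and> q t = q0 t"
        \<comment> \<open>The forward rotation is the inverse rotation by the opposite angle.\<close>
        using rotation_inverse[of "- t" "p0 t" "q0 t"]
        unfolding p_def q_def conjunct1[OF xz] conjunct2[OF xz]
        by (simp add: algebra_simps)
    qed
    then show ?thesis
      by blast
  qed
  also have "(\<lambda>t. cos t * p0 t + sin t * q0 t) =
      (\<lambda>t. 1 / \<omega>\<^sup>2 * (\<omega> * sin t * sin (\<omega> * t) - u * cos t * (cos (\<omega> * t) - 1)))"
    unfolding p0_def q0_def using \<omega>(1) by (simp add: fun_eq_iff field_simps power2_eq_square)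
  also have "(\<lambda>t. cos t * q0 t - sin t * p0 t) =
      (\<lambda>t. 1 / \<omega>\<^sup>2 * (\<omega> * cos t * sin (\<omega> * t) + u * sin t * (cos (\<omega> * t) - 1)))"
    unfolding p0_def q0_def using \<omega>(1) by (simp add: fun_eq_iff field_simps power2_eq_square)
  finally show ?thesis
    unfolding y0_def .
qed

theorem mainTheorem2:
  fixes Ixx Iyy Izz I_BR I_BY Ixx' Izz' \<alpha> \<beta> c1 c2 u1 \<sigma> lam :: real
    and T :: "real set"
    and x y z :: "real \<Rightarrow> real"
  assumes "Ixx > 0" and "Iyy > 0" and "Izz > 0" and "I_BR > 0" and "I_BY > 0"
    and "Ixx' = Ixx + I_BR" and "Izz' = Izz + I_BR"
    and "\<alpha> = ((Ixx - Izz) * (Ixx - Iyy + 2 * I_BR + Izz)) / (2 * (I_BR + Izz) * (Ixx + I_BR))"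
    and "\<beta> = - ((Ixx - Iyy - Izz) / (I_BR + Izz))"
    and "c1 = - ((Ixx - Izz) / (2 * (I_BY + Iyy)))"
    and "c2 = - (((Izz + I_BR) * (Ixx + Iyy - Izz)) / ((I_BY + Iyy) * (Ixx + I_BR)))"
    and "u1 = 2 * \<alpha> + \<beta> - 1"
    and "\<sigma> = - ((Iyy - Ixx') * (Iyy - Izz'))"
    and "\<sigma> < 0"
    and "lam = sqrt (- \<sigma> / (Ixx' * Izz'))"
    and "is_interval T" and "0 \<in> T"
  shows "first_order_ivp_solution \<alpha> \<beta> c1 c2 T x y z \<longleftrightarrow>
    (\<forall>\<tau>\<in>T.
       x \<tau> = 1 / lam\<^sup>2 * (lam * sin \<tau> * sin (lam * \<tau>) - u1 * cos \<tau> * (cos (lam * \<tau>) - 1)) \<and>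
       y \<tau> = c1 * u1 / lam ^ 4 * (cos (lam * \<tau>) - 1)\<^sup>2 - c2 / lam\<^sup>2 * (cos (lam * \<tau>) - 1) \<and>
       z \<tau> = 1 / lam\<^sup>2 * (lam * cos \<tau> * sin (lam * \<tau>) + u1 * sin \<tau> * (cos (lam * \<tau>) - 1)))"
proof (rule first_order_ivp_solution_iff)
  have X: "Ixx' > 0" and Z: "Izz' > 0"
    using assms by simp_all
  have \<beta>: "\<beta> - 1 = (Iyy - Ixx') / Izz'"
    using assms(6,7,9) Z by (simp add: field_simps)
  have "Ixx - Izz = Ixx' - Izz'" "Ixx - Iyy + 2 * I_BR + Izz = Ixx' + Izz' - Iyy"
    "I_BR + Izz = Izz'" "Ixx + I_BR = Ixx'"
    using assms(6,7) by simp_all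
  then have \<alpha>: "\<alpha> = (Ixx' - Izz') * (Ixx' + Izz' - Iyy) / (2 * Izz' * Ixx')"
    using assms(8) by (simp only:)
  have "u1 = 2 * \<alpha> + (\<beta> - 1)"
    using assms(12) by simp
  also have "\<dots> = (Iyy - Izz') / Ixx'"
    unfolding \<alpha> \<beta> using X Z by (simp add: field_simps)
  finally have u1: "u1 = (Iyy - Izz') / Ixx'" .
  have "- \<sigma> / (Ixx' * Izz') > 0"
    using \<open>\<sigma> < 0\<close> X Z by (intro divide_pos_pos mult_pos_pos) simp_all
  then have lam: "lam > 0" "lam\<^sup>2 = - \<sigma> / (Ixx' * Izz')"
    using assms(15) by simp_all
  show "lam \<noteq> 0"
    using lam(1) by simp
  show "lam\<^sup>2 = u1 * (\<beta> - 1)"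
    unfolding lam(2) u1 \<beta> assms(13) by (simp add: mult.commute)
qed (use assms in auto)

end
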